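(* Let $N\ge1$, let $b$ and $p_i,q_i,\alpha_i,\beta_i$ ($i=1,\dots,N$) be constants with $$q_i=-p_i-b\qquad(i=1,\dots,N),$$ and let $a_k(l_k)$ ($k=1,2$) be arbitrary functions of the indicated variables. Put $$\varphi_{i,l_1,l_2}^{s}=\alpha_i p_i^s\prod_{k=1}^2\prod_{j_k}^{l_k-1}(1-a_k(j_k)p_i)^{-1}+\beta_i q_i^s\prod_{k=1}^2\prod_{j_k}^{l_k-1}(1-a_k(j_k)q_i)^{-1},$$ and let $\sigma=\sigma_{l_1,l_2}^s=\det\left(\varphi_{i,l_1,l_2}^{s+j-1}\right)_{i,j=1,\dots,N}$. Then $\sigma$ satisfies the bilinear equations $$(1+a_k(l_k)b)\,\sigma_{l_k+1}^{s+2}\,\sigma-\sigma_{l_k+1}\,\sigma^{s+2}=a_k(l_k)b\,\sigma_{l_k+1}^{s+1}\,\sigma^{s+1}\qquad(k=1,2),$$ and, for fixed $s$, the function $$z_{l_1,l_2}=\left[\prod_{k=1}^2\prod_{j_k}^{l_k-1}(1+a_k(j_k)b)\right]\frac{\sigma^{s+2}}{\sigma}$$ satisfies the discrete Schwarzian KdV equation $$\frac{(z-z_{l_1+1})(z_{l_1+1,l_2+1}-z_{l_2+1})}{(z_{l_1+1}-z_{l_1+1,l_2+1})(z_{l_2+1}-z)}=\frac{\lambda(l_1)}{\mu(l_2)}$$ with $\lambda(l_1)=a_1(l_1)^2/(1+a_1(l_1)b)$ and $\mu(l_2)=a_2(l_2)^2/(1+a_2(l_2)b)$.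
   Context: The variables $l_1,l_2,s$ are integers and all functions are complex-valued. Only shifted independent variables are displayed: $\sigma=\sigma_{l_1,l_2}^s$, $\sigma_{l_k+1}^{s+2}$ is $\sigma$ with $l_k$ raised by one and $s$ raised by two, $z=z_{l_1,l_2}$, $z_{l_1+1}=z_{l_1+1,l_2}$, etc. The symbol $\prod_{j}^{l-1}g(j)$ denotes an indefinite product with an arbitrary fixed lower limit, i.e. a function $G(l)$ with $G(l+1)=g(l)G(l)$ (the same lower limit for each $k$ throughout). Quantities occurring in denominators or raised to negative powers are understood to be nonzero. *)

theory Defs
  imports Complex_Main "Jordan_Normal_Form.Determinant"
begin

text \<open>
  An operator \<open>IP\<close> assigning to each nowhere vanishing \<open>g\<close> on the integers an indefinite product
  \<open>l \<mapsto> IP g l\<close>, written \<open>\<Prod>\<^sub>j\<^bsup>l-1\<^esup> g(j)\<close> in the literature. Only the defining recurrence is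
  required, so no lower limit or normalisation is singled out. Nonvanishing of \<open>g\<close> is what
  makes the recurrence solvable to the left of a lower limit, where values of \<open>g\<close> are divided by.
\<close>

definition indefinite_product :: "((int \<Rightarrow> complex) \<Rightarrow> int \<Rightarrow> complex) \<Rightarrow> bool" where
  "indefinite_product IP \<longleftrightarrow>
     (\<forall>g. (\<forall>j. g j \<noteq> 0) \<longrightarrow> (\<forall>l. IP g (l + 1) = g l * IP g l))"

text \<open>
  The product with an explicit lower limit \<open>c\<close>: it is \<open>g(c) \<dots> g(l-1)\<close> for \<open>l \<ge> c\<close> and
  \<open>1 / (g(l) \<dots> g(c-1))\<close> for \<open>l < c\<close>, since one of the two intervals is always empty.
\<close>

definition prod_from :: "int \<Rightarrow> (int \<Rightarrow> complex) \<Rightarrow> int \<Rightarrow> complex" where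
  "prod_from c g l = (\<Prod>j\<in>{c..<l}. g j) / (\<Prod>j\<in>{l..<c}. g j)"

lemma indefinite_product_prod_from: "indefinite_product (prod_from c)"
  unfolding indefinite_product_def
proof (intro allI impI)
  fix g :: "int \<Rightarrow> complex" and l :: int
  assume g: "\<forall>j. g j \<noteq> 0"
  show "prod_from c g (l + 1) = g l * prod_from c g l"
  proof (cases "c \<le> l")
    case True
    then have "{c..<l + 1} = insert l {c..<l}" by auto
    with True show ?thesis by (simp add: prod_from_def)
  next
    case False
    then have "{l..<c} = insert l {l + 1..<c}" by auto
    with False g show ?thesis by (simp add: prod_from_def)
  qed
qed

end

theory Submission
  imports Defs
begin

text \<open>
  Let \<open>g\<close> be \<open>\<phi>\<close> with \<open>l\<^sub>k\<close> raised by one. Then \<open>\<phi>\<^sup>s = g\<^sup>s - a g\<^bsup>s+1\<^esup>\<close>, and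
  \<open>q\<^sub>i = - p\<^sub>i - b\<close> gives \<open>g\<^bsup>s+2\<^esup> + b g\<^bsup>s+1\<^esup> = - p\<^sub>i q\<^sub>i g\<^sup>s\<close>. Hence, up to the common factor
  \<open>\<Prod>(- p\<^sub>i q\<^sub>i)\<close>, all six determinants of the bilinear equation are \<open>N \<times> N\<close> determinants in the
  columns \<open>g\<^bsup>s+1\<^esup>, \<dots>, g\<^bsup>s+N+2\<^esup>\<close>. Identifying these columns with the monomials \<open>1, \<dots>, T\<^bsup>N+1\<^esup>\<close>, each
  of the six corresponds to the polynomials vanishing at two of the four points \<open>0\<close>, \<open>- b\<close>,
  \<open>1 / a\<close>, \<open>\<infinity>\<close>, and the bilinear equation is the three-term Pluecker relation for these points.
  By the bilinear equations the differences of \<open>z\<close> along the edges of a lattice square factor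
  into values of \<open>\<sigma>\<close>, which cancel in the cross-ratio.
\<close>

section \<open>Determinants given by entry functions\<close>

text \<open>Taking the entries as a function on all pairs of naturals lets \<open>case_nat\<close>
  prepend rows and \<open>Suc\<close> shift columns without any carrier bookkeeping.\<close>

definition fdet :: "nat \<Rightarrow> (nat \<Rightarrow> nat \<Rightarrow> 'a::comm_ring_1) \<Rightarrow> 'a" where
  "fdet n A = det (mat n n (\<lambda>(i, j). A i j))"

lemma fdet_cong:
  assumes "\<And>i j. i < n \<Longrightarrow> j < n \<Longrightarrow> A i j = B i j"
  shows "fdet n A = fdet n B"
proof -
  have "mat n n (\<lambda>(i, j). A i j) = mat n n (\<lambda>(i, j). B i j)"
    using assms by (intro cong_mat) auto
  then show ?thesis
    by (simp add: fdet_def)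
qed

lemma fdet_leibniz:
  "fdet n A = (\<Sum>p | p permutes {0..<n}. signof p * (\<Prod>i = 0..<n. A i (p i)))"
proof -
  have "(\<Prod>i = 0..<n. mat n n (\<lambda>(i, j). A i j) $$ (i, p i)) = (\<Prod>i = 0..<n. A i (p i))"
    if "p permutes {0..<n}" for p
    using permutes_in_image[OF that] by (intro prod.cong) auto
  then show ?thesis
    unfolding fdet_def by (subst det_def'[of _ n]) (auto intro!: sum.cong)
qed

lemma fdet_scale_rows:
  "fdet n (\<lambda>i j. c i * A i j) = (\<Prod>i<n. c i) * fdet n A"
  by (simp add: fdet_leibniz prod.distrib sum_distrib_left mult.left_commute atLeast0LessThan)

text \<open>Here \<open>case_nat r M\<close> is \<open>M\<close> with the row \<open>r\<close> put
  on top, and the inner conditional skips column \<open>j\<close>. The minors do not involve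
  \<open>r\<close>, so the expansion exhibits linearity in the first row.\<close>

lemma fdet_case_nat_laplace:
  "fdet (Suc n) (case_nat r M) =
    (\<Sum>j\<le>n. r j * ((- 1) ^ j * fdet n (\<lambda>i k. M i (if k < j then k else Suc k))))"
proof -
  let ?A = "mat (Suc n) (Suc n) (\<lambda>(i, j). case_nat r M i j)"
  have del: "det (mat_delete ?A 0 j) = fdet n (\<lambda>i k. M i (if k < j then k else Suc k))"
    if "j < Suc n" for j
    unfolding fdet_def by (rule arg_cong[where f = det]) (rule eq_matI, auto simp: mat_delete_def)
  have "det ?A = (\<Sum>j<Suc n. ?A $$ (0, j) * cofactor ?A 0 j)"
    by (rule laplace_expansion_row) auto
  also have "\<dots> = (\<Sum>j<Suc n. r j * ((- 1) ^ j * fdet n (\<lambda>i k. M i (if k < j then k else Suc k))))"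
    by (rule sum.cong) (auto simp: cofactor_def del)
  finally show ?thesis
    by (simp add: fdet_def lessThan_Suc_atMost)
qed

lemma fdet_scale_first_row:
  "fdet (Suc n) (case_nat (\<lambda>j. c * r j) M) = c * fdet (Suc n) (case_nat r M)"
  by (simp add: fdet_case_nat_laplace sum_distrib_left mult.assoc)

lemma fdet_first_row_unit_zero:
  assumes "\<And>j. j \<le> n \<Longrightarrow> r j = (if j = 0 then 1 else 0)"
  shows "fdet (Suc n) (case_nat r M) = fdet n (\<lambda>i j. M i (Suc j))"
  using assms by (simp add: fdet_case_nat_laplace if_distrib[of "\<lambda>x. x * _"] cong: if_cong)

lemma fdet_first_row_unit_last:
  assumes "\<And>j. j \<le> n \<Longrightarrow> r j = (if j = n then 1 else 0)"
  shows "fdet (Suc n) (case_nat r M) = (- 1) ^ n * fdet n M"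
proof -
  have "fdet (Suc n) (case_nat r M) = (- 1) ^ n * fdet n (\<lambda>i k. M i (if k < n then k else Suc k))"
    using assms by (simp add: fdet_case_nat_laplace if_distrib[of "\<lambda>x. x * _"] cong: if_cong)
  also have "fdet n (\<lambda>i k. M i (if k < n then k else Suc k)) = fdet n M"
    by (rule fdet_cong) simp
  finally show ?thesis .
qed

section \<open>Column operations and rows of powers\<close>

lemma fdet_mult:
  "fdet n (\<lambda>i j. \<Sum>k<n. A i k * B k j) = fdet n A * fdet n B"
proof -
  have "mat n n (\<lambda>(i, j). \<Sum>k<n. A i k * B k j) = mat n n (\<lambda>(i, j). A i j) * mat n n (\<lambda>(i, j). B i j)"
    by (rule eq_matI) (auto simp: scalar_prod_def atLeast0LessThan)
  then show ?thesis
    by (simp add: fdet_def det_mult[of _ n])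
qed

lemma fdet_unit_upper_triangular:
  assumes "\<And>i j. j < i \<Longrightarrow> i < n \<Longrightarrow> A i j = 0" and "\<And>i. i < n \<Longrightarrow> A i i = 1"
  shows "fdet n A = 1"
proof -
  have "fdet n A = prod_list (diag_mat (mat n n (\<lambda>(i, j). A i j)))"
    unfolding fdet_def by (rule det_upper_triangular[of _ n]) (auto intro!: upper_triangularI assms)
  also have "\<dots> = 1"
    unfolding prod_list_diag_prod by (rule prod.neutral) (simp add: assms)
  finally show ?thesis .
qed

lemma fdet_unit_lower_triangular:
  assumes "\<And>i j. i < j \<Longrightarrow> j < n \<Longrightarrow> A i j = 0" and "\<And>i. i < n \<Longrightarrow> A i i = 1"
  shows "fdet n A = 1"
proof -
  have "fdet n A = prod_list (diag_mat (mat n n (\<lambda>(i, j). A i j)))"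
    unfolding fdet_def by (rule det_lower_triangular[of n]) (auto simp: assms)
  also have "\<dots> = 1"
    unfolding prod_list_diag_prod by (rule prod.neutral) (simp add: assms)
  finally show ?thesis .
qed

text \<open>Right multiplication by a unit bidiagonal matrix alters all columns at once, so the
  neighbour subtracted from each column is the original one.\<close>

lemma fdet_subtract_previous_columns:
  "fdet n A = fdet n (\<lambda>i j. if j = 0 then A i 0 else A i j - t * A i (j - 1))"
proof -
  define B :: "nat \<Rightarrow> nat \<Rightarrow> 'a" where
    "B k j = (if k = j then 1 else 0) + (if j \<noteq> 0 \<and> k = j - 1 then - t else 0)" for k j
  have "fdet n B = 1"
    by (rule fdet_unit_upper_triangular) (auto simp: B_def)
  moreover have "(\<Sum>k<n. A i k * B k j) = (if j = 0 then A i 0 else A i j - t * A i (j - 1))"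
    if "i < n" "j < n" for i j
  proof -
    have "(\<Sum>k<n. A i k * B k j) = (\<Sum>k<n. if k = j then A i k else 0)
        + (\<Sum>k<n. if k = j - 1 then (if j \<noteq> 0 then - t * A i k else 0) else 0)"
      unfolding sum.distrib[symmetric] by (rule sum.cong) (auto simp: B_def algebra_simps)
    then show ?thesis
      using that by (simp add: sum.delta)
  qed
  then have "fdet n (\<lambda>i j. \<Sum>k<n. A i k * B k j)
      = fdet n (\<lambda>i j. if j = 0 then A i 0 else A i j - t * A i (j - 1))"
    by (rule fdet_cong)
  ultimately show ?thesis
    by (simp only: fdet_mult mult_1_right)
qed

lemma fdet_subtract_next_columns:
  "fdet n A = fdet n (\<lambda>i j. if Suc j = n then A i j else A i j - t * A i (Suc j))"
proof -
  define B :: "nat \<Rightarrow> nat \<Rightarrow> 'a" where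
    "B k j = (if k = j then 1 else 0) + (if k = Suc j then - t else 0)" for k j
  have "fdet n B = 1"
    by (rule fdet_unit_lower_triangular) (auto simp: B_def)
  moreover have "(\<Sum>k<n. A i k * B k j) = (if Suc j = n then A i j else A i j - t * A i (Suc j))"
    if "i < n" "j < n" for i j
  proof -
    have "(\<Sum>k<n. A i k * B k j) = (\<Sum>k<n. if k = j then A i k else 0)
        + (\<Sum>k<n. if k = Suc j then - t * A i k else 0)"
      unfolding sum.distrib[symmetric] by (rule sum.cong) (auto simp: B_def algebra_simps)
    then show ?thesis
      using that by (auto simp: sum.delta)
  qed
  then have "fdet n (\<lambda>i j. \<Sum>k<n. A i k * B k j)
      = fdet n (\<lambda>i j. if Suc j = n then A i j else A i j - t * A i (Suc j))"
    by (rule fdet_cong)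
  ultimately show ?thesis
    by (simp only: fdet_mult mult_1_right)
qed

text \<open>The column operation reduces the row of powers to \<open>(1, 0, ..., 0)\<close>. With
  columns read as monomials \<open>T^j\<close>, adjoining the evaluation at \<open>t\<close> thus
  selects the multiples \<open>T^j * (T - t)\<close>, a basis of the polynomials vanishing at
  \<open>t\<close>.\<close>

lemma fdet_ascending_powers_row:
  "fdet (Suc n) (case_nat (\<lambda>j. t ^ j) M) = fdet n (\<lambda>i j. M i (Suc j) - t * M i j)"
proof -
  have "fdet (Suc n) (case_nat (\<lambda>j. t ^ j) M)
      = fdet (Suc n) (case_nat (\<lambda>j. if j = 0 then 1 else 0)
          (\<lambda>i j. if j = 0 then M i 0 else M i j - t * M i (j - 1)))"
    by (subst fdet_subtract_previous_columns[where t = t], rule fdet_cong)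
      (auto split: nat.split simp flip: power_Suc)
  then show ?thesis
    by (simp add: fdet_first_row_unit_zero)
qed

text \<open>The mirror image: the row evaluates at \<open>1 / t\<close>, scaled by
  \<open>t ^ n\<close>, and the new columns stand for \<open>T^j * (1 - t * T)\<close>. The sign
  comes from expanding at the last column.\<close>

lemma fdet_descending_powers_row:
  "fdet (Suc n) (case_nat (\<lambda>j. t ^ (n - j)) M) = (- 1) ^ n * fdet n (\<lambda>i j. M i j - t * M i (Suc j))"
proof -
  have "fdet (Suc n) (case_nat (\<lambda>j. t ^ (n - j)) M)
      = fdet (Suc n) (case_nat (\<lambda>j. if j = n then 1 else 0)
          (\<lambda>i j. if j = n then M i j else M i j - t * M i (Suc j)))"
    by (subst fdet_subtract_next_columns[where t = t], rule fdet_cong)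
      (auto split: nat.split simp: Suc_diff_Suc simp flip: power_Suc)
  also have "\<dots> = (- 1) ^ n * fdet n (\<lambda>i j. if j = n then M i j else M i j - t * M i (Suc j))"
    by (rule fdet_first_row_unit_last) simp
  also have "fdet n (\<lambda>i j. if j = n then M i j else M i j - t * M i (Suc j))
      = fdet n (\<lambda>i j. M i j - t * M i (Suc j))"
    by (rule fdet_cong) simp
  finally show ?thesis .
qed

section \<open>The three-term Pluecker relation\<close>

lemma fdet_equal_rows:
  assumes "i < n" "k < n" "i \<noteq> k" "A i = A k"
  shows "fdet n A = 0"
  unfolding fdet_def
  by (rule det_identical_rows[of _ n i k]) (use assms in \<open>auto intro!: eq_vecI\<close>)

lemma fdet_swap_first_rows:
  "fdet (Suc (Suc n)) (case_nat x (case_nat y M)) = - fdet (Suc (Suc n)) (case_nat y (case_nat x M))"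
proof -
  let ?n = "Suc (Suc n)"
  have "mat ?n ?n (\<lambda>(i, j). case_nat x (case_nat y M) i j)
      = swaprows 0 1 (mat ?n ?n (\<lambda>(i, j). case_nat y (case_nat x M) i j))"
    by (rule eq_matI) (auto split: nat.split)
  then show ?thesis
    by (simp add: fdet_def det_swaprows[of _ ?n])
qed

text \<open>A nonzero determinant yields an inverse matrix \<open>B\<close>, and the coefficients
  \<open>v\<close> are the row vector \<open>z\<close> times \<open>B\<close>.\<close>

lemma fdet_nonzero_row_span:
  fixes A :: "nat \<Rightarrow> nat \<Rightarrow> 'a::field"
  assumes "fdet n A \<noteq> 0"
  obtains v where "\<And>j. j < n \<Longrightarrow> z j = (\<Sum>i<n. v i * A i j)"
proof -
  let ?A = "mat n n (\<lambda>(i, j). A i j)"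
  have "?A \<in> Units (ring_mat TYPE('a) n ())"
    using assms by (intro det_non_zero_imp_unit) (auto simp: fdet_def)
  then obtain B where B: "B \<in> carrier_mat n n" and inv: "B * ?A = 1\<^sub>m n"
    by (auto simp: Units_def ring_mat_def)
  show ?thesis
  proof
    fix j assume j: "j < n"
    have one: "(\<Sum>i<n. B $$ (k, i) * A i j) = (if k = j then 1 else 0)" if "k < n" for k
    proof -
      have "(B * ?A) $$ (k, j) = (\<Sum>i<n. B $$ (k, i) * A i j)"
        using B j that by (auto simp: scalar_prod_def atLeast0LessThan intro!: sum.cong)
      then show ?thesis
        using j that by (simp add: inv)
    qed
    have "(\<Sum>i<n. (\<Sum>k<n. z k * B $$ (k, i)) * A i j) = (\<Sum>k<n. z k * (\<Sum>i<n. B $$ (k, i) * A i j))"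
      by (simp add: sum_distrib_left sum_distrib_right mult.assoc) (rule sum.swap)
    also have "\<dots> = (\<Sum>k<n. z k * (if k = j then 1 else 0))"
      by (intro sum.cong) (simp_all add: one)
    also have "\<dots> = z j"
      using j by (simp add: sum.delta if_distrib[of "\<lambda>x. _ * x"] cong: if_cong)
    finally show "z j = (\<Sum>i<n. (\<Sum>k<n. z k * B $$ (k, i)) * A i j)"
      by simp
  qed
qed

text \<open>If one bracket \<open>[x y]\<close> is nonzero, then \<open>z\<close> is a combination of \<open>x\<close>, \<open>y\<close> and the common
  rows, and the common rows contribute nothing to \<open>[z w]\<close>.\<close>

lemma fdet_pluecker_nonzero:
  fixes M :: "nat \<Rightarrow> nat \<Rightarrow> 'a::field" and n :: nat
  defines "F \<equiv> \<lambda>x y. fdet (Suc (Suc n)) (case_nat x (case_nat y M))"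
  assumes nz: "F x y \<noteq> 0"
  shows "F x y * F z w - F x z * F y w + F x w * F y z = 0"
proof -
  let ?A = "case_nat x (case_nat y M)"
  obtain v where v: "\<And>j. j < Suc (Suc n) \<Longrightarrow> z j = (\<Sum>i<Suc (Suc n). v i * ?A i j)"
    using fdet_nonzero_row_span[of "Suc (Suc n)" ?A z] nz unfolding F_def by blast
  have expand: "F z u = v 0 * F x u + v 1 * F y u" for u
  proof -
    let ?K = "\<lambda>j. (- 1) ^ j * fdet (Suc n) (\<lambda>i k. case_nat u M i (if k < j then k else Suc k))"
    have row: "F r u = (\<Sum>j\<le>Suc n. r j * ?K j)" for r
      unfolding F_def by (rule fdet_case_nat_laplace)
    have common: "F (M i) u = 0" if "i < n" for i
      unfolding F_def by (rule fdet_equal_rows[of 0 _ "Suc (Suc i)"]) (use that in auto)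
    have "F z u = (\<Sum>j\<le>Suc n. (\<Sum>i<Suc (Suc n). v i * ?A i j) * ?K j)"
      unfolding row by (intro sum.cong refl) (simp only: v atMost_iff less_Suc_eq_le)
    also have "\<dots> = (\<Sum>i<Suc (Suc n). v i * (\<Sum>j\<le>Suc n. ?A i j * ?K j))"
      unfolding sum_distrib_left sum_distrib_right mult.assoc by (rule sum.swap)
    also have "\<dots> = (\<Sum>i<Suc (Suc n). v i * F (?A i) u)"
      by (simp only: row)
    also have "\<dots> = v 0 * F x u + v 1 * F y u"
      by (simp add: sum.lessThan_Suc_shift common del: sum.lessThan_Suc)
    finally show ?thesis .
  qed
  have alt: "F u u = 0" for u
    unfolding F_def by (rule fdet_equal_rows[of 0 _ 1]) auto
  have anti: "F u u' = - F u' u" for u u'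
    unfolding F_def by (rule fdet_swap_first_rows)
  \<comment> \<open>Cramer's rule: taking \<open>u\<close> to be \<open>x\<close> or
    \<open>y\<close> in \<open>expand\<close> leaves one term, since the bracket alternates.\<close>
  have "F x z = v 1 * F x y" "F y z = - (v 0 * F x y)"
    using expand[of x] expand[of y] anti[of x z] anti[of y z] anti[of x y] alt by simp_all
  then show ?thesis
    by (simp add: expand[of w] algebra_simps)
qed

text \<open>Each term contains exactly one of the brackets \<open>F x y\<close>,
  \<open>F x z\<close>, \<open>F x w\<close>. If one is nonzero, renaming rows makes it the leading
  bracket; otherwise every term vanishes.\<close>

lemma fdet_pluecker:
  fixes M :: "nat \<Rightarrow> nat \<Rightarrow> 'a::field" and n :: nat
  defines "F \<equiv> \<lambda>x y. fdet (Suc (Suc n)) (case_nat x (case_nat y M))"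
  shows "F x y * F z w - F x z * F y w + F x w * F y z = 0"
proof -
  have anti: "F u u' = - F u' u" for u u'
    unfolding F_def by (rule fdet_swap_first_rows)
  consider "F x y \<noteq> 0" | "F x z \<noteq> 0" | "F x w \<noteq> 0" | "F x y = 0" "F x z = 0" "F x w = 0"
    by blast
  then show ?thesis
  proof cases
    case 1
    then show ?thesis
      using fdet_pluecker_nonzero[of n x y M z w] by (simp add: F_def)
  next
    case 2
    then have "F x z * F y w - F x y * F z w + F x w * F z y = 0"
      using fdet_pluecker_nonzero[of n x z M y w] by (simp add: F_def)
    then show ?thesis
      using anti[of z y] by (simp add: algebra_simps)
  next
    case 3
    then have "F x w * F y z - F x y * F w z + F x z * F w y = 0"
      using fdet_pluecker_nonzero[of n x w M y z] by (simp add: F_def)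
    then show ?thesis
      using anti[of w y] anti[of w z] by (simp add: algebra_simps)
  qed simp
qed

text \<open>The four extra rows are the evaluations of polynomials of degree at most \<open>n + 1\<close> at
  \<open>0\<close>, \<open>- b\<close>, \<open>1 / a\<close> (scaled so that \<open>a = 0\<close> is allowed) and \<open>\<infinity>\<close> (the leading coefficient).\<close>

lemma fdet_shift_identity:
  fixes m :: "nat \<Rightarrow> nat \<Rightarrow> 'a::field"
  shows "(1 + a * b) * fdet n (\<lambda>i j. m i (Suc j))
        * fdet n (\<lambda>i j. (m i (Suc j) + b * m i j) - a * (m i (Suc (Suc j)) + b * m i (Suc j)))
      - fdet n (\<lambda>i j. m i (Suc j) + b * m i j) * fdet n (\<lambda>i j. m i (Suc j) - a * m i (Suc (Suc j)))
    = a * b * fdet n (\<lambda>i j. m i (Suc (Suc j)) + b * m i (Suc j)) * fdet n (\<lambda>i j. m i j - a * m i (Suc j))"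
    (is "(1 + a * b) * ?A1 * ?B1 - ?A2 * ?B2 = a * b * ?A3 * ?B3")
proof -
  define F where "F x y = fdet (Suc (Suc n)) (case_nat x (case_nat y m))" for x y
  \<comment> \<open>As points of the projective line, \<open>asc t\<close> is \<open>(1 : t)\<close>
    and \<open>desc t\<close> is \<open>(t : 1)\<close>. Because \<open>0 ^ 0 = 1\<close>, the row
    \<open>asc 0\<close> picks the constant coefficient and \<open>desc 0\<close> the leading
    one.\<close>
  define asc desc :: "'a \<Rightarrow> nat \<Rightarrow> 'a"
    where "asc t j = t ^ j" and "desc t j = t ^ (Suc n - j)" for t j
  have F_asc: "F (asc t) y
      = fdet (Suc n) (case_nat (\<lambda>j. y (Suc j) - t * y j) (\<lambda>i j. m i (Suc j) - t * m i j))" for t y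
    unfolding F_def asc_def[abs_def] fdet_ascending_powers_row
    by (rule fdet_cong) (auto split: nat.split)
  have F_desc: "F (desc t) y = (- 1) ^ Suc n
      * fdet (Suc n) (case_nat (\<lambda>j. y j - t * y (Suc j)) (\<lambda>i j. m i j - t * m i (Suc j)))" for t y
    unfolding F_def desc_def[abs_def] fdet_descending_powers_row
    by (intro arg_cong2[where f = "(*)"] refl fdet_cong) (auto split: nat.split)
  \<comment> \<open>Eliminating one special row turns the other into a row of powers one degree
    lower, times a scalar. Up to sign, this scalar is the 2 by 2 determinant of the two points; the
    same happens in the next two cases.\<close>
  have asc_asc: "F (asc t) (asc u)
      = (u - t) * fdet n (\<lambda>i j. (m i (Suc (Suc j)) - t * m i (Suc j)) - u * (m i (Suc j) - t * m i j))" for t u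
  proof -
    have "(\<lambda>j. asc u (Suc j) - t * asc u j) = (\<lambda>j. (u - t) * u ^ j)"
      by (auto simp: asc_def algebra_simps)
    then show ?thesis
      by (simp only: F_asc fdet_scale_first_row fdet_ascending_powers_row)
  qed
  have asc_desc: "F (asc t) (desc u) = (1 - t * u) * ((- 1) ^ n
      * fdet n (\<lambda>i j. (m i (Suc j) - t * m i j) - u * (m i (Suc (Suc j)) - t * m i (Suc j))))" for t u
  proof -
    have "F (asc t) (desc u) = fdet (Suc n) (case_nat (\<lambda>j. (1 - t * u) * u ^ (n - j)) (\<lambda>i j. m i (Suc j) - t * m i j))"
      unfolding F_asc
      by (rule fdet_cong) (auto split: nat.split simp: desc_def Suc_diff_le algebra_simps)
    then show ?thesis
      by (simp only: fdet_scale_first_row fdet_descending_powers_row)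
  qed
  have desc_desc: "F (desc t) (desc u) = (- 1) ^ Suc n * ((u - t) * ((- 1) ^ n
      * fdet n (\<lambda>i j. (m i j - t * m i (Suc j)) - u * (m i (Suc j) - t * m i (Suc (Suc j))))))" for t u
  proof -
    have "F (desc t) (desc u) = (- 1) ^ Suc n
        * fdet (Suc n) (case_nat (\<lambda>j. (u - t) * u ^ (n - j)) (\<lambda>i j. m i j - t * m i (Suc j)))"
      unfolding F_desc
      by (intro arg_cong2[where f = "(*)"] refl fdet_cong)
        (auto split: nat.split simp: desc_def Suc_diff_le algebra_simps)
    then show ?thesis
      by (simp only: fdet_scale_first_row fdet_descending_powers_row)
  qed
  have anti: "F u u' = - F u' u" for u u'
    unfolding F_def by (rule fdet_swap_first_rows)
  have sign: "(- 1) ^ n * (- 1) ^ n = (1 :: 'a)"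
    by (simp flip: power_mult_distrib)
  have "F (asc 0) (desc 0) = (- 1) ^ n * ?A1"
    using asc_desc[of 0 0] by simp
  moreover have "F (asc (- b)) (desc a) = (1 + a * b) * ((- 1) ^ n * ?B1)"
    using asc_desc[of "- b" a] by (simp add: mult.commute)
  moreover have "F (asc (- b)) (desc 0) = (- 1) ^ n * ?A2"
    using asc_desc[of "- b" 0] by simp
  moreover have "F (asc 0) (desc a) = (- 1) ^ n * ?B2"
    using asc_desc[of 0 a] by simp
  moreover have "F (asc 0) (asc (- b)) = - b * ?A3"
    using asc_asc[of 0 "- b"] by simp
  moreover have "F (desc 0) (desc a) = - a * ?B3"
    using desc_desc[of 0 a] sign by simp
  moreover have "F (asc 0) (desc 0) * F (asc (- b)) (desc a) - F (asc 0) (asc (- b)) * F (desc 0) (desc a)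
      + F (asc 0) (desc a) * F (desc 0) (asc (- b)) = 0"
    using fdet_pluecker[of n "asc 0" "desc 0" m "asc (- b)" "desc a"] by (simp add: F_def)
  moreover have "F (desc 0) (asc (- b)) = - F (asc (- b)) (desc 0)"
    by (rule anti)
  ultimately have "((- 1) ^ n * ?A1) * ((1 + a * b) * ((- 1) ^ n * ?B1)) - (- b * ?A3) * (- a * ?B3)
      + ((- 1) ^ n * ?B2) * - ((- 1) ^ n * ?A2) = 0"
    by metis
  \<comment> \<open>The sign \<open>(- 1) ^ n\<close> becomes an arbitrary \<open>e\<close> with
    \<open>e * e = 1\<close>, leaving a pure ring identity.\<close>
  moreover have "(1 + a * b) * A1 * B1 - A2 * B2 = a * b * A3 * B3"
    if "(e * A1) * ((1 + a * b) * (e * B1)) - (- b * A3) * (- a * B3) + (e * B2) * - (e * A2) = 0"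
      and "e * e = 1" for e A1 A2 A3 B1 B2 B3 :: 'a
  proof -
    have "(e * e) * ((1 + a * b) * A1 * B1 - A2 * B2) = a * b * A3 * B3"
      using that(1) by (simp add: algebra_simps)
    then show ?thesis
      by (simp add: that(2))
  qed
  ultimately show ?thesis
    using sign by blast
qed

section \<open>Bilinear equations for Casorati determinants\<close>

definition casorati :: "nat \<Rightarrow> (nat \<Rightarrow> int \<Rightarrow> 'a::comm_ring_1) \<Rightarrow> int \<Rightarrow> 'a" where
  "casorati N f s = fdet N (\<lambda>i j. f i (s + int j))"

text \<open>For the theorem, \<open>f\<close> is \<phi> and \<open>g\<close> is \<phi> with one
  lattice variable raised, so one statement serves both directions. The recurrence trades the column
  combination with \<open>b\<close> for the row factors \<open>c i\<close>.\<close>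

lemma casorati_bilinear:
  fixes f g :: "nat \<Rightarrow> int \<Rightarrow> 'a::field"
  assumes shift: "\<And>i s. i < N \<Longrightarrow> f i s = g i s - a * g i (s + 1)"
    and rec: "\<And>i s. i < N \<Longrightarrow> g i (s + 2) + b * g i (s + 1) = c i * g i s"
    and nz: "\<And>i. i < N \<Longrightarrow> c i \<noteq> 0"
  shows "(1 + a * b) * casorati N g (s + 2) * casorati N f s - casorati N g s * casorati N f (s + 2)
      = a * b * casorati N g (s + 1) * casorati N f (s + 1)"
proof -
  define C where "C = (\<Prod>i<N. c i)"
  have "C \<noteq> 0"
    using nz by (simp add: C_def)
  \<comment> \<open>The window starts at \<open>s + 1\<close>, not \<open>s\<close>: the columns at
    \<open>s\<close> are recovered from it by \<open>rec\<close>, up to row factors.\<close>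
  define m where "m i j = g i (s + 1 + int j)" for i j
  have rec_m: "m i (Suc j) + b * m i j = c i * g i (s + int j)" if "i < N" for i j
    using rec[OF that, of "s + int j"] by (simp add: m_def add_ac)
  have "fdet N (\<lambda>i j. m i (Suc j)) = casorati N g (s + 2)"
    and "fdet N (\<lambda>i j. m i (Suc j) - a * m i (Suc (Suc j))) = casorati N f (s + 2)"
    and "fdet N (\<lambda>i j. m i j - a * m i (Suc j)) = casorati N f (s + 1)"
    unfolding casorati_def by (rule fdet_cong; simp add: m_def shift add_ac)+
  moreover have "fdet N (\<lambda>i j. m i (Suc j) + b * m i j) = C * casorati N g s"
    unfolding C_def casorati_def fdet_scale_rows[symmetric] by (rule fdet_cong) (rule rec_m)
  moreover have "fdet N (\<lambda>i j. m i (Suc (Suc j)) + b * m i (Suc j)) = C * casorati N g (s + 1)"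
    unfolding C_def casorati_def fdet_scale_rows[symmetric]
    by (rule fdet_cong) (simp add: rec_m add_ac)
  moreover have "fdet N (\<lambda>i j. (m i (Suc j) + b * m i j) - a * (m i (Suc (Suc j)) + b * m i (Suc j)))
      = C * casorati N f s"
    unfolding C_def casorati_def fdet_scale_rows[symmetric]
    by (rule fdet_cong) (simp only: rec_m shift, simp add: algebra_simps)
  \<comment> \<open>In each of the three products exactly one determinant carries the factor
    \<open>C\<close>, so it cancels.\<close>
  ultimately have "C * ((1 + a * b) * casorati N g (s + 2) * casorati N f s - casorati N g s * casorati N f (s + 2))
      = C * (a * b * casorati N g (s + 1) * casorati N f (s + 1))"
    using fdet_shift_identity[of a b N m] by (simp add: algebra_simps)
  with \<open>C \<noteq> 0\<close> show ?thesis
    by simp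
qed


theorem theorem2p6:
  fixes N :: nat
    and b :: complex
    and p q \<alpha> \<beta> :: "nat \<Rightarrow> complex"
    and a1 a2 :: "int \<Rightarrow> complex"
    and IP1 IP2 :: "(int \<Rightarrow> complex) \<Rightarrow> int \<Rightarrow> complex"
    and \<phi> :: "nat \<Rightarrow> int \<Rightarrow> int \<Rightarrow> int \<Rightarrow> complex"
    and \<sigma> z :: "int \<Rightarrow> int \<Rightarrow> int \<Rightarrow> complex"
    and lam mu :: "int \<Rightarrow> complex"
  assumes N: "N \<ge> 1"
    and q: "\<And>i. i \<in> {1..N} \<Longrightarrow> q i = - p i - b"
    and IP: "indefinite_product IP1" "indefinite_product IP2"
    and nonzero_pq: "\<And>i. i \<in> {1..N} \<Longrightarrow> p i \<noteq> 0 \<and> q i \<noteq> 0"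
    and nonzero_a1: "\<And>i j. i \<in> {1..N} \<Longrightarrow> 1 - a1 j * p i \<noteq> 0 \<and> 1 - a1 j * q i \<noteq> 0"
    and nonzero_a2: "\<And>i j. i \<in> {1..N} \<Longrightarrow> 1 - a2 j * p i \<noteq> 0 \<and> 1 - a2 j * q i \<noteq> 0"
    and \<phi>: "\<And>i s l1 l2. \<phi> i s l1 l2 =
          \<alpha> i * p i powi s * (IP1 (\<lambda>j. inverse (1 - a1 j * p i)) l1 * IP2 (\<lambda>j. inverse (1 - a2 j * p i)) l2)
        + \<beta> i * q i powi s * (IP1 (\<lambda>j. inverse (1 - a1 j * q i)) l1 * IP2 (\<lambda>j. inverse (1 - a2 j * q i)) l2)"
    \<comment> \<open>matrix indices start at 0, so the 1-based entry \<open>(i, j)\<close> is at \<open>(i - 1, j - 1)\<close>\<close>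
    and \<sigma>: "\<And>s l1 l2. \<sigma> s l1 l2 = det (mat N N (\<lambda>(i, j). \<phi> (i + 1) (s + int j) l1 l2))"
    and z: "\<And>s l1 l2. z s l1 l2 =
          (IP1 (\<lambda>j. 1 + a1 j * b) l1 * IP2 (\<lambda>j. 1 + a2 j * b) l2) * (\<sigma> (s + 2) l1 l2 / \<sigma> s l1 l2)"
    and lam: "\<And>l1. lam l1 = (a1 l1)\<^sup>2 / (1 + a1 l1 * b)"
    and mu: "\<And>l2. mu l2 = (a2 l2)\<^sup>2 / (1 + a2 l2 * b)"
  shows
    "(\<forall>s l1 l2.
        (1 + a1 l1 * b) * \<sigma> (s + 2) (l1 + 1) l2 * \<sigma> s l1 l2 - \<sigma> s (l1 + 1) l2 * \<sigma> (s + 2) l1 l2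
          = a1 l1 * b * \<sigma> (s + 1) (l1 + 1) l2 * \<sigma> (s + 1) l1 l2
      \<and> (1 + a2 l2 * b) * \<sigma> (s + 2) l1 (l2 + 1) * \<sigma> s l1 l2 - \<sigma> s l1 (l2 + 1) * \<sigma> (s + 2) l1 l2
          = a2 l2 * b * \<sigma> (s + 1) l1 (l2 + 1) * \<sigma> (s + 1) l1 l2)
   \<and> ((\<forall>j. 1 + a1 j * b \<noteq> 0) \<and> (\<forall>j. 1 + a2 j * b \<noteq> 0) \<longrightarrow>
      (\<forall>s l1 l2.
        \<sigma> s l1 l2 \<noteq> 0 \<and> \<sigma> s (l1 + 1) l2 \<noteq> 0 \<and> \<sigma> s l1 (l2 + 1) \<noteq> 0 \<and> \<sigma> s (l1 + 1) (l2 + 1) \<noteq> 0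
        \<and> z s (l1 + 1) l2 - z s (l1 + 1) (l2 + 1) \<noteq> 0 \<and> z s l1 (l2 + 1) - z s l1 l2 \<noteq> 0
        \<and> mu l2 \<noteq> 0 \<longrightarrow>
        ((z s l1 l2 - z s (l1 + 1) l2) * (z s (l1 + 1) (l2 + 1) - z s l1 (l2 + 1)))
          / ((z s (l1 + 1) l2 - z s (l1 + 1) (l2 + 1)) * (z s l1 (l2 + 1) - z s l1 l2))
          = lam l1 / mu l2))"
proof -

  \<comment> \<open>The bilinear equations for \<sigma>\<close>
  define c where "c i = - (p (Suc i) * q (Suc i))" for i
  have c: "c i \<noteq> 0" if "i < N" for i
    using nonzero_pq[of "Suc i"] that by (simp add: c_def)
  have \<sigma>_casorati: "\<sigma> s l1 l2 = casorati N (\<lambda>i s. \<phi> (Suc i) s l1 l2) s" for s l1 l2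
    by (simp add: \<sigma> casorati_def fdet_def)
  have rec: "\<phi> (Suc i) (s + 2) l1 l2 + b * \<phi> (Suc i) (s + 1) l1 l2 = c i * \<phi> (Suc i) s l1 l2"
    if "i < N" for i s l1 l2
  proof -
    \<comment> \<open>The map \<open>x\<close> to \<open>- x - b\<close> exchanges \<open>p\<close>
      and \<open>q\<close>, so both exponentials satisfy the recurrence with the same constant
      \<open>c i\<close>, and hence so does their sum \<phi>.\<close>
    have "x powi (s + 2) + b * x powi (s + 1) = - (x * (- x - b)) * x powi s" if "x \<noteq> 0" for x :: complex
      using that by (simp add: power_int_add power2_eq_square algebra_simps)
    from this[of "p (Suc i)"] this[of "q (Suc i)"]
    have "p (Suc i) powi (s + 2) + b * p (Suc i) powi (s + 1) = c i * p (Suc i) powi s"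
      and "q (Suc i) powi (s + 2) + b * q (Suc i) powi (s + 1) = c i * q (Suc i) powi s"
      using nonzero_pq[of "Suc i"] q[of "Suc i"] that by (auto simp: c_def mult.commute)
    moreover have "\<alpha>' * x2 * A + \<beta>' * y2 * B + b * (\<alpha>' * x1 * A + \<beta>' * y1 * B)
        = c' * (\<alpha>' * x0 * A + \<beta>' * y0 * B)"
      if "x2 + b * x1 = c' * x0" and "y2 + b * y1 = c' * y0" for \<alpha>' \<beta>' x0 x1 x2 y0 y1 y2 A B c'
    proof -
      have "x2 = c' * x0 - b * x1" and "y2 = c' * y0 - b * y1"
        using that by (simp_all add: eq_diff_eq)
      then show ?thesis
        by (simp only:) (simp add: algebra_simps)
    qed
    ultimately show ?thesis
      unfolding \<phi> by blast
  qed
  have IP_inverse: "IP (\<lambda>j. inverse (1 - a j * x)) l = (1 - a l * x) * IP (\<lambda>j. inverse (1 - a j * x)) (l + 1)"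
    if "indefinite_product IP" "\<And>j. 1 - a j * x \<noteq> 0" for IP a and x :: complex and l
    using that by (simp add: indefinite_product_def)
  have powi_Suc: "p (Suc i) powi (s + 1) = p (Suc i) powi s * p (Suc i)"
      "q (Suc i) powi (s + 1) = q (Suc i) powi s * q (Suc i)" if "i < N" for i s
    using nonzero_pq[of "Suc i"] that by (simp_all add: power_int_add)
  \<comment> \<open>Lowering \<open>l1\<close> multiplies each summand by
    \<open>1 - a1 l1 * x\<close>, with \<open>x\<close> its base \<open>p\<close> or
    \<open>q\<close>; a factor \<open>x\<close> raises \<open>s\<close> by one.\<close>
  have shift1: "\<phi> (Suc i) s l1 l2 = \<phi> (Suc i) s (l1 + 1) l2 - a1 l1 * \<phi> (Suc i) (s + 1) (l1 + 1) l2"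
    if "i < N" for i s l1 l2
  proof -
    have IP_p: "IP1 (\<lambda>j. inverse (1 - a1 j * p (Suc i))) l1
        = (1 - a1 l1 * p (Suc i)) * IP1 (\<lambda>j. inverse (1 - a1 j * p (Suc i))) (l1 + 1)"
      and IP_q: "IP1 (\<lambda>j. inverse (1 - a1 j * q (Suc i))) l1
        = (1 - a1 l1 * q (Suc i)) * IP1 (\<lambda>j. inverse (1 - a1 j * q (Suc i))) (l1 + 1)"
      using nonzero_a1[of "Suc i"] that by (auto intro!: IP_inverse IP)
    show ?thesis
      unfolding \<phi> IP_p IP_q powi_Suc[OF that] by (simp add: algebra_simps)
  qed
  have shift2: "\<phi> (Suc i) s l1 l2 = \<phi> (Suc i) s l1 (l2 + 1) - a2 l2 * \<phi> (Suc i) (s + 1) l1 (l2 + 1)"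
    if "i < N" for i s l1 l2
  proof -
    have IP_p: "IP2 (\<lambda>j. inverse (1 - a2 j * p (Suc i))) l2
        = (1 - a2 l2 * p (Suc i)) * IP2 (\<lambda>j. inverse (1 - a2 j * p (Suc i))) (l2 + 1)"
      and IP_q: "IP2 (\<lambda>j. inverse (1 - a2 j * q (Suc i))) l2
        = (1 - a2 l2 * q (Suc i)) * IP2 (\<lambda>j. inverse (1 - a2 j * q (Suc i))) (l2 + 1)"
      using nonzero_a2[of "Suc i"] that by (auto intro!: IP_inverse IP)
    show ?thesis
      unfolding \<phi> IP_p IP_q powi_Suc[OF that] by (simp add: algebra_simps)
  qed
  have bilinear1: "(1 + a1 l1 * b) * \<sigma> (s + 2) (l1 + 1) l2 * \<sigma> s l1 l2 - \<sigma> s (l1 + 1) l2 * \<sigma> (s + 2) l1 l2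
      = a1 l1 * b * \<sigma> (s + 1) (l1 + 1) l2 * \<sigma> (s + 1) l1 l2" for s l1 l2
    unfolding \<sigma>_casorati by (rule casorati_bilinear[OF shift1 rec c])
  have bilinear2: "(1 + a2 l2 * b) * \<sigma> (s + 2) l1 (l2 + 1) * \<sigma> s l1 l2 - \<sigma> s l1 (l2 + 1) * \<sigma> (s + 2) l1 l2
      = a2 l2 * b * \<sigma> (s + 1) l1 (l2 + 1) * \<sigma> (s + 1) l1 l2" for s l1 l2
    unfolding \<sigma>_casorati by (rule casorati_bilinear[OF shift2 rec c])

  \<comment> \<open>The discrete Schwarzian KdV equation\<close>
  define P where "P l1 l2 = IP1 (\<lambda>j. 1 + a1 j * b) l1 * IP2 (\<lambda>j. 1 + a2 j * b) l2" for l1 l2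
  have "((z s l1 l2 - z s (l1 + 1) l2) * (z s (l1 + 1) (l2 + 1) - z s l1 (l2 + 1)))
        / ((z s (l1 + 1) l2 - z s (l1 + 1) (l2 + 1)) * (z s l1 (l2 + 1) - z s l1 l2))
        = lam l1 / mu l2"
    if nz: "\<forall>j. 1 + a1 j * b \<noteq> 0" "\<forall>j. 1 + a2 j * b \<noteq> 0"
      and \<sigma>nz: "\<sigma> s l1 l2 \<noteq> 0" "\<sigma> s (l1 + 1) l2 \<noteq> 0" "\<sigma> s l1 (l2 + 1) \<noteq> 0" "\<sigma> s (l1 + 1) (l2 + 1) \<noteq> 0"
      and znz: "z s (l1 + 1) l2 - z s (l1 + 1) (l2 + 1) \<noteq> 0" "z s l1 (l2 + 1) - z s l1 l2 \<noteq> 0"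
    for s l1 l2
  proof -
    have P1: "P (l1 + 1) l2 = (1 + a1 l1 * b) * P l1 l2" and P2: "P l1 (l2 + 1) = (1 + a2 l2 * b) * P l1 l2" for l1 l2
      using IP nz by (simp_all add: P_def indefinite_product_def)
    \<comment> \<open>The factor gained by \<open>P\<close> is the coefficient
      \<open>1 + a1 l1 * b\<close> of the bilinear equation, so over a common denominator the
      difference has the left side of that equation as numerator.\<close>
    have d1: "z s (l1 + 1) l2 - z s l1 l2
        = P l1 l2 * (a1 l1 * b * \<sigma> (s + 1) (l1 + 1) l2 * \<sigma> (s + 1) l1 l2) / (\<sigma> s (l1 + 1) l2 * \<sigma> s l1 l2)"
      if "\<sigma> s l1 l2 \<noteq> 0" "\<sigma> s (l1 + 1) l2 \<noteq> 0" for l1 l2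
      unfolding z P_def[symmetric] P1 bilinear1[symmetric] using that by (simp add: divide_simps) (simp add: algebra_simps)
    have d2: "z s l1 (l2 + 1) - z s l1 l2
        = P l1 l2 * (a2 l2 * b * \<sigma> (s + 1) l1 (l2 + 1) * \<sigma> (s + 1) l1 l2) / (\<sigma> s l1 (l2 + 1) * \<sigma> s l1 l2)"
      if "\<sigma> s l1 l2 \<noteq> 0" "\<sigma> s l1 (l2 + 1) \<noteq> 0" for l1 l2
      unfolding z P_def[symmetric] P2 bilinear2[symmetric] using that by (simp add: divide_simps) (simp add: algebra_simps)
    have d: "z s l1 l2 - z s (l1 + 1) l2 = - (z s (l1 + 1) l2 - z s l1 l2)"
      "z s (l1 + 1) l2 - z s (l1 + 1) (l2 + 1) = - (z s (l1 + 1) (l2 + 1) - z s (l1 + 1) l2)"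
      by simp_all
    \<comment> \<open>By \<open>d2\<close> the two nonzero differences in the denominator are
      products, so all their factors are nonzero.\<close>
    have ne: "P l1 l2 \<noteq> 0" "a2 l2 \<noteq> 0" "b \<noteq> 0" "\<sigma> (s + 1) l1 l2 \<noteq> 0" "\<sigma> (s + 1) l1 (l2 + 1) \<noteq> 0"
        "\<sigma> (s + 1) (l1 + 1) l2 \<noteq> 0" "\<sigma> (s + 1) (l1 + 1) (l2 + 1) \<noteq> 0"
      using znz unfolding d d2[OF \<sigma>nz(1,3)] d2[OF \<sigma>nz(2,4)] by auto
    \<comment> \<open>Numerator and denominator each contain \<sigma> at \<open>s + 1\<close> once
      for every corner of the square, so these values cancel. The shifted prefactors
      \<open>P l1 (l2 + 1)\<close> above and \<open>P (l1 + 1) l2\<close> below supply the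
      denominators of \<open>lam\<close> and \<open>mu\<close>.\<close>
    show ?thesis
      unfolding d d1[OF \<sigma>nz(1,2)] d1[OF \<sigma>nz(3,4)] d2[OF \<sigma>nz(1,3)] d2[OF \<sigma>nz(2,4)] P1 P2 lam mu
      using ne \<sigma>nz nz by (simp add: divide_simps power2_eq_square)
  qed
  with bilinear1 bilinear2 show ?thesis
    by blast
qed

end
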